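(* Let $0<\alpha<1$, $x>0$ and $y\in C^\infty[0,x]$. For integers $n\ge 4$ put $h=x/n$, $y_j=y(jh)$ for $0\le j\le n$, and define $$\sigma_0^{(\alpha)}=\zeta(\alpha)-\zeta(1+\alpha),\qquad \sigma_1^{(\alpha)}=1-\zeta(\alpha),\qquad \sigma_k^{(\alpha)}=\frac{1}{k^{1+\alpha}}\quad (2\le k\le n-2),$$ $$\sigma_{n-1}^{(\alpha)}=\frac{1}{(n-1)^{1+\alpha}}-nS_n[\alpha+1]+S_n[\alpha]-\frac{n^{1-\alpha}}{\alpha(1-\alpha)},\qquad \sigma_n^{(\alpha)}=(n-1)S_n[\alpha+1]-S_n[\alpha]+\frac{n^{1-\alpha}}{\alpha(1-\alpha)}.$$ Then, as $n\to\infty$ with $x$ fixed, $$\frac{1}{\Gamma(-\alpha)h^\alpha}\sum_{k=0}^{n}\sigma_k^{(\alpha)}y_{n-k}=y^{(\alpha)}(x)+O\left(h^{2-\alpha}\right).$$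
   Context: $\zeta$ is the Riemann zeta function (analytically continued). $S_n[a]=\sum_{k=1}^{n-1}k^{-a}-\zeta(a)$. For $0<\alpha<1$ the Caputo derivative is $y^{(\alpha)}(x)=\frac{1}{\Gamma(1-\alpha)}\int_0^x\frac{y'(t)}{(x-t)^\alpha}\,dt$. The constant implied by $O(\cdot)$ may depend on $y,\alpha,x$ but not on $n$. *)

theory Defs
  imports
    "HOL-Complex_Analysis.Complex_Analysis"
    "HOL-Library.Landau_Symbols"
begin

text \<open>
  The Riemann zeta function on the complex plane without 1, by analytic continuation of its
  Dirichlet series. The continuation is taken in punctured half-planes
  \<open>{z. Re z > c} - {1}\<close> with \<open>c \<le> 1\<close>: these exhaust the plane without 1 and are connected, so the
  value at a point depends neither on \<open>c\<close> nor on \<open>f\<close> (lemma \<open>zeta_eqI\<close>). At 1 the value is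
  unspecified.
\<close>

definition is_zeta_continuation :: "real \<Rightarrow> (complex \<Rightarrow> complex) \<Rightarrow> bool" where
  "is_zeta_continuation c f \<longleftrightarrow>
     c \<le> 1 \<and> f holomorphic_on ({z. Re z > c} - {1}) \<and>
     (\<forall>z. Re z > 1 \<longrightarrow> (\<lambda>k. of_nat (Suc k) powr (- z)) sums f z)"

definition zeta :: "complex \<Rightarrow> complex" where
  "zeta s = (THE w. \<exists>c f. is_zeta_continuation c f \<and> c < Re s \<and> w = f s)"

lemma is_zeta_continuation_unique:
  assumes f: "is_zeta_continuation c f" and g: "is_zeta_continuation d g"
    and s: "c < Re s" "d < Re s" "s \<noteq> 1"
  shows "f s = g s"
proof -
  let ?S = "{z. Re z > max c d} - {1}"
  have "connected ?S"
    by (intro connected_open_delete open_halfspace_Re_gt convex_connected convex_halfspace_Re_gt) simp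
  moreover have "open ?S"
    by (intro open_delete open_halfspace_Re_gt)
  moreover have "f holomorphic_on ?S" "g holomorphic_on ?S"
    using f g by (auto simp: is_zeta_continuation_def elim!: holomorphic_on_subset)
  moreover have "f z = g z" if "z \<in> {z. Re z > 1}" for z
    using f g that sums_unique2 unfolding is_zeta_continuation_def by blast
  moreover have "{z. Re z > 1} \<noteq> {}"
    by (auto intro!: exI[of _ 2])
  moreover have "{z. Re z > 1} \<subseteq> ?S"
    using f g by (auto simp: is_zeta_continuation_def)
  ultimately show ?thesis
    using s by (intro analytic_continuation_open[of "{z. Re z > 1}" ?S f g s])
      (auto simp: open_halfspace_Re_gt)
qed

lemma zeta_eqI:
  assumes "is_zeta_continuation c f" "c < Re s" "s \<noteq> 1"
  shows "zeta s = f s"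
  unfolding zeta_def
  using assms by (intro the_equality) (auto intro: is_zeta_continuation_unique)

text \<open>\<open>zeta\<close> takes real values on the real axis (away from 1), so \<open>Re\<close> is only a coercion.\<close>

definition zeta_real :: "real \<Rightarrow> real" where
  "zeta_real a = Re (zeta (complex_of_real a))"

text \<open>\<open>y\<close> is infinitely differentiable on \<open>S\<close>, with one-sided derivatives at the endpoints when
  \<open>S\<close> is a closed interval; only the values of \<open>y\<close> on \<open>S\<close> matter.\<close>

definition C_infinity_on :: "real set \<Rightarrow> (real \<Rightarrow> real) \<Rightarrow> bool" where
  "C_infinity_on S y \<longleftrightarrow>
     (\<exists>D. (\<forall>t\<in>S. D (0::nat) t = y t) \<and>
          (\<forall>k. \<forall>t\<in>S. (D k has_real_derivative D (Suc k) t) (at t within S)))"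

text \<open>The convention \<open>a / 0 = 0\<close> makes the integrand 0 at \<open>t = x\<close>, a null set.\<close>

definition caputo_derivative :: "real \<Rightarrow> (real \<Rightarrow> real) \<Rightarrow> real \<Rightarrow> real" where
  "caputo_derivative \<alpha> y x =
     1 / Gamma (1 - \<alpha>) *
     integral {0..x} (\<lambda>t. vector_derivative y (at t within {0..x}) / (x - t) powr \<alpha>)"

definition S_zeta :: "nat \<Rightarrow> real \<Rightarrow> real" where
  "S_zeta n a = (\<Sum>k = 1..n - 1. real k powr (- a)) - zeta_real a"

text \<open>For \<open>n \<ge> 4\<close> the cases are pairwise disjoint; the last one covers \<open>2 \<le> k \<le> n - 2\<close>
  (and irrelevant \<open>k > n\<close>).\<close>

definition \<sigma> :: "real \<Rightarrow> nat \<Rightarrow> nat \<Rightarrow> real" where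
  "\<sigma> \<alpha> n k =
     (if k = 0 then zeta_real \<alpha> - zeta_real (1 + \<alpha>)
      else if k = 1 then 1 - zeta_real \<alpha>
      else if k = n - 1 then
        1 / (real n - 1) powr (1 + \<alpha>) - real n * S_zeta n (\<alpha> + 1) + S_zeta n \<alpha>
          - real n powr (1 - \<alpha>) / (\<alpha> * (1 - \<alpha>))
      else if k = n then
        (real n - 1) * S_zeta n (\<alpha> + 1) - S_zeta n \<alpha> + real n powr (1 - \<alpha>) / (\<alpha> * (1 - \<alpha>))
      else 1 / real k powr (1 + \<alpha>))"

end

theory Submission
  imports Defs
begin

text \<open>
  Reflect: with \<open>g s = y (x - s)\<close> the sum is \<open>\<Sum>k \<sigma>\<^sub>k g (k h)\<close> and the Caputo derivative is a multiple of
  \<open>\<integral> g' s * s powr - \<alpha>\<close> over \<open>[0, x]\<close>, so the singularity of the kernel sits at \<open>0\<close>. The two end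
  weights \<open>\<sigma>\<^sub>n\<^sub>-\<^sub>1\<close>, \<open>\<sigma>\<^sub>n\<close> are such that the rule is exact, for every \<open>n \<ge> 4\<close>, on constants and on linear
  functions (\<open>sigma_sum_const\<close>, \<open>sigma_sum_linear\<close>). Hence \<open>g\<close> may be replaced by its Taylor
  remainder \<open>q\<close> of order two at \<open>0\<close>, which satisfies \<open>q s = O(s\<^sup>2)\<close>.

  For such a \<open>q\<close> integration by parts turns the integral into
  \<open>q x * x powr - \<alpha> + \<alpha> * \<integral> \<phi>\<close> with \<open>\<phi> s = q s * s powr (- 1 - \<alpha>)\<close>
  (\<open>has_integral_against_kernel\<close>). The interior weights \<open>k powr (- 1 - \<alpha>)\<close> are exactly those of the
  trapezoid rule for \<open>\<integral> \<phi>\<close>, up to the factor \<open>h powr \<alpha>\<close>. Since \<open>\<phi>'' s = O(s powr (- 1 - \<alpha>))\<close>, the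
  panel starting at \<open>k h\<close> contributes an error \<open>O(h powr (2 - \<alpha>) * k powr (- 1 - \<alpha>))\<close>; this is summable
  over \<open>k\<close>, and the first panel is itself \<open>O(h powr (2 - \<alpha>))\<close>, which gives the order of the
  method (\<open>trapezoid_sum_error\<close>).

  What remains is that the end weights supply the half weight of the trapezoid rule at \<open>x\<close> and the
  boundary term of the integration by parts. This needs the asymptotic expansion
  \<open>S_zeta n a = n powr (1 - a) / (1 - a) - n powr - a / 2 + O(n powr (- a - 1))\<close>
  (\<open>S_zeta_expansion\<close>). Its error term is the tail of a series of trapezoid errors for
  \<open>t powr - s\<close> whose full sum continues the zeta function to \<open>Re s > 0\<close>
  (\<open>zeta_eq_defect_sum\<close>), so the same estimate \<open>trapezoid_error\<close> serves the zeta function and \<open>\<phi>\<close>.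
\<close>

section \<open>The error of the trapezoid rule\<close>

lemma norm_increment_le:
  fixes G :: "real \<Rightarrow> 'a::real_normed_vector"
  assumes "a \<le> t" "t \<le> b"
    and "\<And>s. s \<in> {a..b} \<Longrightarrow> (G has_vector_derivative G' s) (at s within {a..b})"
    and "\<And>s. s \<in> {a..b} \<Longrightarrow> norm (G' s) \<le> B"
  shows "norm (G t - G a) \<le> B * (t - a)"
proof -
  have "norm (G t - G a) \<le> B * norm (t - a)"
  proof (rule differentiable_bound[where S = "{a..b}" and f' = "\<lambda>s h. h *\<^sub>R G' s"])
    fix s assume s: "s \<in> {a..b}"
    show "(G has_derivative (\<lambda>h. h *\<^sub>R G' s)) (at s within {a..b})"
      using assms(3)[OF s] by (simp add: has_vector_derivative_def)
    show "onorm (\<lambda>h. h *\<^sub>R G' s) \<le> B"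
      using assms(4)[OF s] by (intro onorm_le) (auto simp: mult.commute[of B] intro!: mult_left_mono)
  qed (use assms in auto)
  then show ?thesis using assms by simp
qed

text \<open>
  As a function of the right end point, the error vanishes together with its first derivative at \<open>a\<close>,
  and its second derivative is \<open>(t - a) / 2 * f2 t\<close>; integrate twice. Values in a normed space are
  allowed because the rule is applied both to complex powers and to real functions.
\<close>

lemma trapezoid_error:
  fixes F :: "real \<Rightarrow> 'a::real_normed_vector"
  assumes "a \<le> b"
    and F: "\<And>t. t \<in> {a..b} \<Longrightarrow> (F has_vector_derivative f t) (at t within {a..b})"
    and f: "\<And>t. t \<in> {a..b} \<Longrightarrow> (f has_vector_derivative f1 t) (at t within {a..b})"
    and f1: "\<And>t. t \<in> {a..b} \<Longrightarrow> (f1 has_vector_derivative f2 t) (at t within {a..b})"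
    and M: "\<And>t. t \<in> {a..b} \<Longrightarrow> norm (f2 t) \<le> M"
  shows "norm (((b - a) / 2) *\<^sub>R (f a + f b) - (F b - F a)) \<le> M * (b - a) ^ 3 / 2"
proof -
  define G where "G = (\<lambda>t. ((t - a) / 2) *\<^sub>R (f a + f t) - (F t - F a))"
  define G1 where "G1 = (\<lambda>t. ((t - a) / 2) *\<^sub>R f1 t - (1/2) *\<^sub>R (f t - f a))"
  have "0 \<le> M" using order_trans[OF norm_ge_zero M[of a]] assms(1) by simp
  have dG: "(G has_vector_derivative G1 t) (at t within {a..b})" if t: "t \<in> {a..b}" for t
  proof -
    have "(G has_vector_derivative
        ((t - a) / 2) *\<^sub>R (0 + f1 t) + (1 / 2) *\<^sub>R (f a + f t) - (f t - 0)) (at t within {a..b})"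
      unfolding G_def
      by (intro has_vector_derivative_diff has_vector_derivative_add has_vector_derivative_scaleR
          has_vector_derivative_const F[OF t] f[OF t])
        (auto intro!: derivative_eq_intros)
    moreover have "f t = (1 / 2) *\<^sub>R f t + (1 / 2) *\<^sub>R f t"
      by (simp flip: scaleR_add_left)
    from arg_cong[OF this, of "\<lambda>z. (1 / 2) *\<^sub>R (f a + f t) - z"]
    have "(1 / 2) *\<^sub>R (f a + f t) - f t = - ((1 / 2) *\<^sub>R (f t - f a))"
      by (simp add: scaleR_add_right scaleR_diff_right)
    ultimately show ?thesis
      unfolding G1_def by (simp only: add_diff_eq[symmetric] add_0 diff_0_right) simp
  qed
  have dG1: "(G1 has_vector_derivative ((t - a) / 2) *\<^sub>R f2 t) (at t within {a..b})"
    if t: "t \<in> {a..b}" for t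
  proof -
    have "(G1 has_vector_derivative
        ((t - a) / 2) *\<^sub>R f2 t + (1 / 2) *\<^sub>R f1 t - (1 / 2) *\<^sub>R (f1 t - 0)) (at t within {a..b})"
      unfolding G1_def
      by (intro has_vector_derivative_diff has_vector_derivative_scaleR has_vector_derivative_const
          f[OF t] f1[OF t] bounded_linear.has_vector_derivative[OF bounded_linear_scaleR_right])
        (auto intro!: derivative_eq_intros)
    then show ?thesis by simp
  qed
  have b2: "norm (((t - a) / 2) *\<^sub>R f2 t) \<le> (b - a) / 2 * M" if "t \<in> {a..b}" for t
    using M[OF that] that by (auto intro!: mult_mono)
  have b1: "norm (G1 t) \<le> (b - a) / 2 * M * (b - a)" if t: "t \<in> {a..b}" for t
  proof -
    have "norm (G1 t - G1 a) \<le> (b - a) / 2 * M * (t - a)"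
      using t by (intro norm_increment_le[OF _ _ dG1 b2]) auto
    also have "\<dots> \<le> (b - a) / 2 * M * (b - a)"
      using t \<open>0 \<le> M\<close> by (intro mult_left_mono) auto
    finally show ?thesis by (simp add: G1_def)
  qed
  have "norm (G b - G a) \<le> (b - a) / 2 * M * (b - a) * (b - a)"
    by (intro norm_increment_le[OF _ _ dG b1]) (use assms(1) in auto)
  then show ?thesis by (simp add: G_def power3_eq_cube mult_ac)
qed

section \<open>The zeta function to the right of the imaginary axis\<close>

text \<open>
  The trapezoid error for \<open>t powr - s\<close> on \<open>[i + 1, i + 2]\<close>.
\<close>

definition zeta_defect :: "complex \<Rightarrow> nat \<Rightarrow> complex" where
  "zeta_defect s i =
     (of_nat (Suc i) powr (- s) + of_nat (Suc (Suc i)) powr (- s)) / 2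
       - (of_nat (Suc (Suc i)) powr (1 - s) - of_nat (Suc i) powr (1 - s)) / (1 - s)"

lemma has_vector_derivative_of_real_powr:
  assumes "t > 0"
  shows "((\<lambda>t. of_real t powr w :: complex) has_vector_derivative w * of_real t powr (w - 1)) (at t within S)"
proof -
  have "((\<lambda>z. z powr w) has_field_derivative w * of_real t powr (w - 1)) (at (of_real t :: complex))"
    using assms by (intro has_field_derivative_powr) (auto simp: complex_nonpos_Reals_iff)
  then show ?thesis
    by (rule has_vector_derivative_real_field)
qed

lemma norm_zeta_defect_le:
  assumes "s \<noteq> 1" "Re s \<ge> 0"
  shows "norm (zeta_defect s i) \<le> norm (s * (s + 1)) / 2 * real (Suc i) powr (- Re s - 2)"
proof -
  let ?a = "real (Suc i)"
  let ?M = "norm (s * (s + 1)) * ?a powr (- Re s - 2)"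
  have "norm (((?a + 1 - ?a) / 2) *\<^sub>R (of_real ?a powr (- s) + of_real (?a + 1) powr (- s))
      - (of_real (?a + 1) powr (1 - s) / (1 - s) - of_real ?a powr (1 - s) / (1 - s)))
    \<le> ?M * (?a + 1 - ?a) ^ 3 / 2"
  proof (rule trapezoid_error[where ?f1.0 = "\<lambda>t. - s * of_real t powr (- s - 1)"
        and ?f2.0 = "\<lambda>t. s * (s + 1) * of_real t powr (- s - 2)"])
    fix t assume t: "t \<in> {?a..?a + 1}"
    then have t0: "t > 0" by auto
    have "((\<lambda>t. (1 / (1 - s)) * of_real t powr (1 - s)) has_vector_derivative
        (1 / (1 - s)) * ((1 - s) * of_real t powr (1 - s - 1))) (at t within {?a..?a + 1})"
      by (intro has_vector_derivative_mult_right has_vector_derivative_of_real_powr t0)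
    then show "((\<lambda>t. of_real t powr (1 - s) / (1 - s)) has_vector_derivative
        of_real t powr (- s)) (at t within {?a..?a + 1})"
      using assms(1) by simp
    show "((\<lambda>t. of_real t powr (- s)) has_vector_derivative
        - s * of_real t powr (- s - 1)) (at t within {?a..?a + 1})"
      by (intro has_vector_derivative_of_real_powr t0)
    have "((\<lambda>t. - s * of_real t powr (- s - 1)) has_vector_derivative
        - s * ((- s - 1) * of_real t powr (- s - 1 - 1))) (at t within {?a..?a + 1})"
      by (intro has_vector_derivative_mult_right has_vector_derivative_of_real_powr t0)
    moreover have "- s - 1 - 1 = - s - 2" by simp
    ultimately show "((\<lambda>t. - s * of_real t powr (- s - 1)) has_vector_derivative
        s * (s + 1) * of_real t powr (- s - 2)) (at t within {?a..?a + 1})"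
      by (simp add: algebra_simps)
    have "norm (of_real t powr (- s - 2) :: complex) = t powr (- Re s - 2)"
      using t0 by (subst norm_powr_real_powr) auto
    also have "\<dots> \<le> ?a powr (- Re s - 2)"
      using t assms by (intro powr_mono2') auto
    finally show "norm (s * (s + 1) * of_real t powr (- s - 2)) \<le> ?M"
      by (simp add: norm_mult mult_left_mono)
  qed auto
  moreover have "complex_of_real ?a = of_nat (Suc i)" "complex_of_real (?a + 1) = of_nat (Suc (Suc i))"
    "?a + 1 - ?a = 1"
    by simp_all
  ultimately show ?thesis
    by (simp add: zeta_defect_def scaleR_conv_of_real diff_divide_distrib del: of_nat_Suc of_real_add)
qed

lemma zeta_defect_partial_sum:
  assumes "s \<noteq> 1"
  shows "(\<Sum>i<m. zeta_defect s i) =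
    (\<Sum>i<m. of_nat (Suc i) powr (- s)) + of_nat (Suc m) powr (- s) / 2 - 1 / 2
      - of_nat (Suc m) powr (1 - s) / (1 - s) + 1 / (1 - s)"
proof (induction m)
  case 0
  then show ?case by simp
next
  case (Suc m)
  then show ?case
    by (simp add: zeta_defect_def add_divide_distrib diff_divide_distrib)
qed

lemma summable_Suc_powr:
  assumes "p < - 1"
  shows "summable (\<lambda>i. real (Suc i) powr p)"
  using assms summable_Suc_iff[of "\<lambda>n. real n powr p"] by (simp add: summable_real_powr_iff)

lemma summable_zeta_defect:
  assumes "s \<noteq> 1" "Re s > 0"
  shows "summable (zeta_defect s)"
proof (rule summable_comparison_test')
  show "summable (\<lambda>i. norm (s * (s + 1)) / 2 * real (Suc i) powr (- Re s - 2))"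
    using assms by (intro summable_mult summable_Suc_powr) auto
  show "norm (zeta_defect s n) \<le> norm (s * (s + 1)) / 2 * real (Suc n) powr (- Re s - 2)" if "n \<ge> 0" for n
    using assms by (intro norm_zeta_defect_le) auto
qed

lemma holomorphic_zeta_defect_sum:
  "(\<lambda>s. \<Sum>i. zeta_defect s i) holomorphic_on ({s. Re s > 0} - {1})"
proof (rule holomorphic_uniform_sequence)
  let ?S = "{s. Re s > 0} - {1::complex}"
  show op: "open ?S" by (intro open_delete open_halfspace_Re_gt)
  show "(\<lambda>s. \<Sum>i<n. zeta_defect s i) holomorphic_on ?S" for n
    unfolding zeta_defect_def by (intro holomorphic_intros) auto
  fix z assume "z \<in> ?S"
  then obtain d where d: "d > 0" "cball z d \<subseteq> ?S"
    using op open_contains_cball by blast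
  have "uniform_limit (cball z d) (\<lambda>n s. \<Sum>i<n. zeta_defect s i) (\<lambda>s. \<Sum>i. zeta_defect s i) sequentially"
  proof (rule Weierstrass_m_test)
    let ?R = "norm z + d"
    show "summable (\<lambda>i. ?R * (?R + 1) / 2 * real (Suc i) powr (- 2))"
      by (intro summable_mult summable_Suc_powr) auto
    fix i s assume s: "s \<in> cball z d"
    then have s': "s \<noteq> 1" "Re s > 0" using d by auto
    have ns: "norm s \<le> ?R"
      using s norm_triangle_ineq2[of s z] by (simp add: dist_norm norm_minus_commute)
    have ns1: "norm (s + 1) \<le> ?R + 1"
      using ns norm_triangle_ineq[of s 1] by simp
    have "norm (zeta_defect s i) \<le> norm (s * (s + 1)) / 2 * real (Suc i) powr (- Re s - 2)"
      using s' by (intro norm_zeta_defect_le) auto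
    also have "\<dots> \<le> ?R * (?R + 1) / 2 * real (Suc i) powr (- 2)"
      unfolding norm_mult using s' ns ns1 d
      by (intro mult_mono divide_right_mono powr_mono) auto
    finally show "norm (zeta_defect s i) \<le> ?R * (?R + 1) / 2 * real (Suc i) powr (- 2)" .
  qed
  with d show "\<exists>d>0. cball z d \<subseteq> ?S \<and>
      uniform_limit (cball z d) (\<lambda>n s. \<Sum>i<n. zeta_defect s i) (\<lambda>s. \<Sum>i. zeta_defect s i) sequentially"
    by blast
qed

lemma of_nat_powr_tendsto_0:
  assumes "Re w < 0"
  shows "(\<lambda>m. of_nat (Suc m) powr w :: complex) \<longlonglongrightarrow> 0"
proof (rule tendsto_norm_zero_cancel)
  have "(\<lambda>m. real (Suc m) powr Re w) \<longlonglongrightarrow> 0"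
    by (intro tendsto_neg_powr[OF assms] filterlim_compose[OF filterlim_real_sequentially filterlim_Suc])
  moreover have "norm (of_nat (Suc m) powr w :: complex) = real (Suc m) powr Re w" for m
    using norm_powr_real_powr[of "of_nat (Suc m)" w] by simp
  ultimately show "(\<lambda>m. norm (of_nat (Suc m) powr w :: complex)) \<longlonglongrightarrow> 0"
    by (simp only:)
qed

text \<open>
  The Euler-Maclaurin formula of first order. The right-hand side is holomorphic where the
  defects, which are \<open>O(i powr (- Re s - 2))\<close>, converge uniformly on compact sets, and for \<open>Re s > 1\<close>
  letting \<open>m\<close> tend to infinity in \<open>zeta_defect_partial_sum\<close> identifies it with the Dirichlet series.
\<close>

lemma zeta_eq_defect_sum:
  assumes "s \<noteq> 1" "Re s > 0"
  shows "zeta s = (\<Sum>i. zeta_defect s i) + 1 / 2 - 1 / (1 - s)"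
proof (rule zeta_eqI[where c = 0])
  show "is_zeta_continuation 0 (\<lambda>s. (\<Sum>i. zeta_defect s i) + 1 / 2 - 1 / (1 - s))"
    unfolding is_zeta_continuation_def
  proof (intro conjI allI impI)
    show "(\<lambda>s. (\<Sum>i. zeta_defect s i) + 1 / 2 - 1 / (1 - s)) holomorphic_on ({z. 0 < Re z} - {1})"
      by (intro holomorphic_intros holomorphic_zeta_defect_sum) auto
    fix z :: complex assume z: "Re z > 1"
    then have z1: "z \<noteq> 1" by auto
    have "(\<lambda>m. \<Sum>i<m. zeta_defect z i) \<longlonglongrightarrow> (\<Sum>i. zeta_defect z i)"
      using z z1 by (intro summable_LIMSEQ summable_zeta_defect) auto
    then have "(\<lambda>m. (\<Sum>i<m. zeta_defect z i) - of_nat (Suc m) powr (- z) / 2 + 1 / 2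
        + of_nat (Suc m) powr (1 - z) / (1 - z) - 1 / (1 - z))
      \<longlonglongrightarrow> (\<Sum>i. zeta_defect z i) - 0 / 2 + 1 / 2 + 0 / (1 - z) - 1 / (1 - z)"
      using z z1 by (intro tendsto_intros of_nat_powr_tendsto_0) auto
    then show "(\<lambda>k. of_nat (Suc k) powr (- z)) sums ((\<Sum>i. zeta_defect z i) + 1 / 2 - 1 / (1 - z))"
      unfolding sums_def zeta_defect_partial_sum[OF z1] by (simp add: algebra_simps)
  qed simp
qed (use assms in auto)

text \<open>
  By \<open>zeta_defect_partial_sum\<close> and \<open>zeta_eq_defect_sum\<close> the difference is minus the tail of the defect
  series, which is dominated by a telescoping series with terms \<open>1 / k - 1 / (k + 1)\<close>.
\<close>

lemma S_zeta_expansion: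
  assumes a: "a > 0" "a \<noteq> 1" and n: "n \<ge> 1"
  shows "\<bar>S_zeta n a - (real n powr (1 - a) / (1 - a) - real n powr (- a) / 2)\<bar>
    \<le> a * (a + 1) * real n powr (- a - 1)"
proof -
  let ?s = "complex_of_real a"
  obtain m where m: "n = Suc m" using n by (cases n) auto
  have s: "?s \<noteq> 1" "Re ?s > 0" using a by auto
  note sm = summable_zeta_defect[OF s]
  have tail: "norm (\<Sum>i. zeta_defect ?s (i + m)) \<le> a * (a + 1) * real n powr (- a - 1)"
  proof -
    let ?g = "\<lambda>i. 1 / real (i + n) - 1 / real (Suc (i + n))"
    have "(\<lambda>i. 1 / real (i + n)) \<longlonglongrightarrow> 0"
      using LIMSEQ_ignore_initial_segment[OF lim_1_over_n] by simp
    from telescope_sums'[OF this] have g: "?g sums (1 / real n)" by simp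
    let ?C = "a * (a + 1) * real n powr (- a)"
    have "norm (\<Sum>i. zeta_defect ?s (i + m)) \<le> (\<Sum>i. ?C * ?g i)"
    proof (rule norm_suminf_le)
      show "summable (\<lambda>i. ?C * ?g i)"
        using g by (intro summable_mult) (auto simp: sums_iff)
      fix i
      define k where "k = real (i + n)"
      have k: "k \<ge> 1" "k \<ge> real n" "real (Suc (i + n)) = k + 1" using n by (auto simp: k_def)
      have "norm (zeta_defect ?s (i + m)) \<le> norm (?s * (?s + 1)) / 2 * k powr (- a - 2)"
        using norm_zeta_defect_le[of ?s "i + m"] s m by (simp add: k_def)
      also have "norm (?s * (?s + 1)) = a * (a + 1)"
      proof -
        have "?s * (?s + 1) = of_real (a * (a + 1))" by simp
        then show ?thesis using a by (simp only: norm_of_real) simp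
      qed
      also have "k powr (- a - 2) = k powr (- a) * (1 / k\<^sup>2)"
        using k by (simp add: powr_diff)
      also have "a * (a + 1) / 2 * (k powr (- a) * (1 / k\<^sup>2))
          \<le> a * (a + 1) / 2 * (real n powr (- a) * (2 * ?g i))"
      proof (intro mult_left_mono mult_mono)
        show "k powr (- a) \<le> real n powr (- a)"
          using k n a by (intro powr_mono2') auto
        have "?g i = 1 / (k * (k + 1))" using k unfolding k(3) k_def[symmetric] by (simp add: field_simps)
        moreover have "k * (k + 1) \<le> 2 * k\<^sup>2"
          using k(1) mult_left_mono[of 1 k k] by (simp add: power2_eq_square algebra_simps)
        then have "2 / (2 * k\<^sup>2) \<le> 2 / (k * (k + 1))"
          using k(1) by (intro divide_left_mono mult_pos_pos) auto
        ultimately show "1 / k\<^sup>2 \<le> 2 * ?g i" by simp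
      qed (use a in auto)
      also have "a * (a + 1) / 2 * (real n powr (- a) * (2 * G)) = ?C * G" for G
        by simp
      finally show "norm (zeta_defect ?s (i + m)) \<le> ?C * ?g i" .
    qed
    also have "\<dots> = ?C * (1 / real n)"
      by (rule sums_unique[OF sums_mult[OF g], symmetric])
    also have "\<dots> = a * (a + 1) * real n powr (- a - 1)"
      using n by (simp add: powr_diff)
    finally show ?thesis .
  qed
  have p: "complex_of_real (real k powr r) = of_nat k powr (of_real r)" for k r
    by (simp add: powr_of_real[symmetric])
  have "of_real (S_zeta n a - (real n powr (1 - a) / (1 - a) - real n powr (- a) / 2))
      = (\<Sum>i<m. of_nat (Suc i) powr (- ?s)) - of_real (zeta_real a)
        - (of_nat n powr (1 - ?s) / (1 - ?s) - of_nat n powr (- ?s) / 2)"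
  proof -
    have "(\<Sum>k = 1..n - 1. real k powr - a) = (\<Sum>i<m. real (Suc i) powr - a)"
      unfolding m by (simp add: sum.atLeast1_atMost_eq)
    then show ?thesis
      unfolding S_zeta_def by (simp only: of_real_diff of_real_sum of_real_divide p) simp
  qed
  also have "of_real (zeta_real a) = zeta ?s"
  proof -
    have "zeta_defect ?s i \<in> \<real>" for i
    proof -
      have e: "- ?s = of_real (- a)" "1 - ?s = of_real (1 - a)" by simp_all
      show ?thesis
        unfolding zeta_defect_def e p[symmetric] by (intro Reals_diff Reals_add Reals_divide) auto
    qed
    then have "Im (zeta_defect ?s i) = 0" for i
      by (simp add: complex_is_Real_iff)
    then have "Im (\<Sum>i. zeta_defect ?s i) = 0"
      using sums_unique[OF sums_Im[OF summable_sums[OF sm]]] by simp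
    moreover have "Im (1 / (1 - ?s)) = 0" by (simp add: Im_divide)
    ultimately have "Im (zeta ?s) = 0"
      unfolding zeta_eq_defect_sum[OF s] by simp
    then show ?thesis
      by (simp add: zeta_real_def complex_eq_iff)
  qed
  also have "zeta ?s = (\<Sum>i<m. zeta_defect ?s i) + (\<Sum>i. zeta_defect ?s (i + m)) + 1 / 2 - 1 / (1 - ?s)"
    using zeta_eq_defect_sum[OF s] suminf_split_initial_segment[OF sm, of m] by simp
  also have "(\<Sum>i<m. of_nat (Suc i) powr (- ?s)) - \<dots>
        - (of_nat n powr (1 - ?s) / (1 - ?s) - of_nat n powr (- ?s) / 2)
      = - (\<Sum>i. zeta_defect ?s (i + m))"
    unfolding zeta_defect_partial_sum[OF s(1)] m by simp
  finally have "complex_of_real (S_zeta n a - (real n powr (1 - a) / (1 - a) - real n powr (- a) / 2))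
     = - (\<Sum>i. zeta_defect ?s (i + m))" .
  then show ?thesis
    using tail by (metis norm_minus_cancel norm_of_real)
qed

section \<open>The weights and their moments\<close>

text \<open>
  Collecting the weights around the pure powers: what the last two weights add to these powers
  is one multiple of a backward difference, whose factor \<open>A\<close> turns out to be \<open>O(1 / n)\<close>, and one
  multiple of the value at the end point.
\<close>

lemma sigma_sum_eq:
  fixes u :: "nat \<Rightarrow> real" and \<alpha> :: real
  assumes "n \<ge> 4"
  defines "A \<equiv> S_zeta n \<alpha> - real n * S_zeta n (\<alpha> + 1) - real n powr (1 - \<alpha>) / (\<alpha> * (1 - \<alpha>))"
  shows "(\<Sum>k = 0..n. \<sigma> \<alpha> n k * u k) =
    (zeta_real \<alpha> - zeta_real (1 + \<alpha>)) * u 0 - zeta_real \<alpha> * u 1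
      + (\<Sum>k = 1..<n. real k powr (- 1 - \<alpha>) * u k)
      + A * (u (n - 1) - u n) - S_zeta n (\<alpha> + 1) * u n"
proof -
  obtain m where m: "n = Suc (Suc m)" "m \<ge> 2"
    using assms(1) by (intro that[of "n - 2"]) auto
  have inv: "1 / real k powr (1 + \<alpha>) = real k powr (- 1 - \<alpha>)" for k
    using powr_minus_divide[of "real k" "1 + \<alpha>"] by simp
  have split1: "sum f {0..m} = f 0 + f 1 + sum f {2..m}" for f :: "nat \<Rightarrow> real"
    using m(2) by (simp add: sum.atLeast_Suc_atMost numeral_2_eq_2)
  have split2: "sum f {1..<n} = f 1 + sum f {2..m} + f (Suc m)" for f :: "nat \<Rightarrow> real"
  proof -
    have "{1..<n} = {1..Suc m}" using m by auto
    then show ?thesis using m(2) by (simp add: sum.atLeast_Suc_atMost numeral_2_eq_2)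
  qed
  have mid: "(\<Sum>k = 2..m. \<sigma> \<alpha> n k * u k) = (\<Sum>k = 2..m. real k powr (- 1 - \<alpha>) * u k)"
    by (intro sum.cong) (auto simp: \<sigma>_def m(1) inv)
  have s0: "\<sigma> \<alpha> n 0 = zeta_real \<alpha> - zeta_real (1 + \<alpha>)" "\<sigma> \<alpha> n 1 = 1 - zeta_real \<alpha>"
    by (simp_all add: \<sigma>_def)
  have s1: "\<sigma> \<alpha> n (Suc m) = real (Suc m) powr (- 1 - \<alpha>) + A"
    using m inv[of "Suc m"] by (simp add: \<sigma>_def A_def)
  have s2: "\<sigma> \<alpha> n (Suc (Suc m)) = - A - S_zeta n (\<alpha> + 1)"
    using m by (simp add: \<sigma>_def A_def algebra_simps)
  have "(\<Sum>k = 0..n. \<sigma> \<alpha> n k * u k)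
      = (\<Sum>k = 0..m. \<sigma> \<alpha> n k * u k) + \<sigma> \<alpha> n (Suc m) * u (Suc m) + \<sigma> \<alpha> n (Suc (Suc m)) * u n"
    by (simp add: m(1))
  then show ?thesis
    unfolding split1 split2 mid s0 s1 s2 by (simp add: m(1) algebra_simps)
qed

lemma sigma_sum_const:
  assumes "n \<ge> 4"
  shows "(\<Sum>k = 0..n. \<sigma> \<alpha> n k) = 0"
proof -
  have "{1..<n} = {1..n - 1}" using assms by auto
  moreover have "- (\<alpha> + 1) = - 1 - \<alpha>" by simp
  ultimately have "S_zeta n (\<alpha> + 1) = (\<Sum>k = 1..<n. real k powr (- 1 - \<alpha>)) - zeta_real (1 + \<alpha>)"
    unfolding S_zeta_def by (simp only: add.commute)
  then show ?thesis
    using sigma_sum_eq[OF assms, of \<alpha> "\<lambda>_. 1"] by simp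
qed

lemma sigma_sum_linear:
  assumes "n \<ge> 4"
  shows "(\<Sum>k = 0..n. \<sigma> \<alpha> n k * real k) = real n powr (1 - \<alpha>) / (\<alpha> * (1 - \<alpha>))"
proof -
  have "{1..<n} = {1..n - 1}" using assms by auto
  then have "S_zeta n \<alpha> = (\<Sum>k = 1..<n. real k powr (- 1 - \<alpha>) * real k) - zeta_real \<alpha>"
    unfolding S_zeta_def by (auto intro!: sum.cong simp: powr_diff powr_minus field_simps)
  then show ?thesis
    using sigma_sum_eq[OF assms, of \<alpha> real] assms by (simp add: of_nat_diff algebra_simps)
qed

section \<open>The trapezoid rule for a function with a double zero against a singular power\<close>

text \<open>
  The function \<open>q\<close> stands for the Taylor remainder of \<open>s \<mapsto> y (x - s)\<close> at \<open>0\<close>.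
\<close>

locale double_zero =
  fixes \<alpha> x M :: real and q q1 q2 :: "real \<Rightarrow> real"
  assumes \<alpha>: "0 < \<alpha>" "\<alpha> < 1" and x: "x > 0"
    and q_deriv: "\<And>s. s \<in> {0..x} \<Longrightarrow> (q has_real_derivative q1 s) (at s within {0..x})"
    and q1_deriv: "\<And>s. s \<in> {0..x} \<Longrightarrow> (q1 has_real_derivative q2 s) (at s within {0..x})"
    and q2_le: "\<And>s. s \<in> {0..x} \<Longrightarrow> \<bar>q2 s\<bar> \<le> M"
    and q_0: "q 0 = 0" and q1_0: "q1 0 = 0"
begin

definition \<phi> :: "real \<Rightarrow> real" where
  "\<phi> s = q s * s powr (- 1 - \<alpha>)"

definition \<Phi> :: "real \<Rightarrow> real" where
  "\<Phi> s = integral {0..s} \<phi>"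

lemma M_nonneg: "0 \<le> M"
  using q2_le[of 0] x by simp

lemma q1_le:
  assumes "s \<in> {0..x}"
  shows "\<bar>q1 s\<bar> \<le> M * s"
  using norm_increment_le[of 0 s x q1 q2 M] assms q1_0 q1_deriv q2_le
  by (simp add: has_real_derivative_iff_has_vector_derivative)

lemma q_diff_le:
  assumes "0 \<le> s" "s \<le> t" "t \<le> x"
  shows "\<bar>q t - q s\<bar> \<le> M * t * (t - s)"
proof -
  have "norm (q t - q s) \<le> M * t * (t - s)"
  proof (rule norm_increment_le[of s t t q q1])
    fix r assume r: "r \<in> {s..t}"
    then have "(q has_real_derivative q1 r) (at r within {s..t})"
      using assms by (intro DERIV_subset[OF q_deriv]) auto
    then show "(q has_vector_derivative q1 r) (at r within {s..t})"
      by (simp add: has_real_derivative_iff_has_vector_derivative)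
    have "\<bar>q1 r\<bar> \<le> M * r" using r assms by (intro q1_le) auto
    also have "\<dots> \<le> M * t" using r M_nonneg by (intro mult_left_mono) auto
    finally show "norm (q1 r) \<le> M * t" by simp
  qed (use assms in auto)
  then show ?thesis by simp
qed

lemma q_le:
  assumes "s \<in> {0..x}"
  shows "\<bar>q s\<bar> \<le> M * s\<^sup>2"
  using q_diff_le[of 0 s] assms q_0 by (simp add: power2_eq_square mult_ac)

lemma q_powr_le:
  assumes "s \<in> {0..x}"
  shows "\<bar>q s * s powr p\<bar> \<le> M * s powr (p + 2)"
proof (cases "s = 0")
  case False
  then have "\<bar>q s * s powr p\<bar> \<le> M * s\<^sup>2 * s powr p"
    using q_le[OF assms] by (simp add: abs_mult mult_right_mono)
  then show ?thesis
    using False assms by (simp add: powr_add mult_ac)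
qed (simp add: q_0)

lemma continuous_on_q_powr:
  assumes "p + 2 > 0"
  shows "continuous_on {0..x} (\<lambda>s. q s * s powr p)"
  unfolding continuous_on_eq_continuous_within
proof
  fix s assume s: "s \<in> {0..x}"
  show "continuous (at s within {0..x}) (\<lambda>s. q s * s powr p)"
  proof (cases "s = 0")
    case True
    have "continuous_on {0..x} (\<lambda>s. M * s powr (p + 2))"
      using assms by (intro continuous_intros continuous_on_powr') auto
    then have "((\<lambda>s. M * s powr (p + 2)) \<longlongrightarrow> 0) (at 0 within {0..x})"
      using x by (fastforce simp: continuous_on_def dest: bspec[of _ _ 0])
    moreover have "\<forall>\<^sub>F s in at 0 within {0..x}. norm (q s * s powr p) \<le> M * s powr (p + 2)"
      using q_powr_le by (auto simp: eventually_at_filter)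
    ultimately have "((\<lambda>s. q s * s powr p) \<longlongrightarrow> 0) (at 0 within {0..x})"
      by (rule Lim_null_comparison[rotated])
    then show ?thesis
      by (simp add: True continuous_within q_0)
  next
    case False
    have "(q \<longlongrightarrow> q s) (at s within {0..x})"
      using DERIV_continuous[OF q_deriv[OF s]] by (simp add: continuous_within)
    then show ?thesis
      unfolding continuous_within using False
      by (intro tendsto_mult tendsto_powr tendsto_ident_at tendsto_const)
  qed
qed

lemma \<Phi>_deriv:
  assumes "s \<in> {0..x}"
  shows "(\<Phi> has_real_derivative \<phi> s) (at s within {0..x})"
proof -
  have "continuous_on {0..x} \<phi>"
    unfolding \<phi>_def using \<alpha> by (intro continuous_on_q_powr) auto
  then show ?thesis
    unfolding \<Phi>_def using assms by (rule integral_has_real_derivative)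
qed

lemma \<Phi>_0: "\<Phi> 0 = 0"
  by (simp add: \<Phi>_def)

lemma powr_has_derivative:
  assumes "s > 0"
  shows "((\<lambda>s. s powr p) has_real_derivative p * s powr (p - 1)) (at s within S)"
  by (rule has_field_derivative_at_within[OF has_real_derivative_powr[OF assms]])

definition \<phi>1 :: "real \<Rightarrow> real" where
  "\<phi>1 s = q1 s * s powr (- 1 - \<alpha>) + q s * ((- 1 - \<alpha>) * s powr (- 2 - \<alpha>))"

definition \<phi>2 :: "real \<Rightarrow> real" where
  "\<phi>2 s = q2 s * s powr (- 1 - \<alpha>) + 2 * (q1 s * ((- 1 - \<alpha>) * s powr (- 2 - \<alpha>)))
     + q s * ((- 1 - \<alpha>) * ((- 2 - \<alpha>) * s powr (- 3 - \<alpha>)))"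

lemma \<phi>_derivs:
  assumes "s \<in> {0<..x}"
  shows "(\<phi> has_real_derivative \<phi>1 s) (at s within {0..x})"
    and "(\<phi>1 has_real_derivative \<phi>2 s) (at s within {0..x})"
proof -
  have s: "s \<in> {0..x}" "s > 0" using assms by auto
  have p: "((\<lambda>s. s powr (- 1 - \<alpha>)) has_real_derivative (- 1 - \<alpha>) * s powr (- 2 - \<alpha>)) (at s within {0..x})"
    using powr_has_derivative[OF s(2), of "- 1 - \<alpha>"] by simp
  have p1: "((\<lambda>s. (- 1 - \<alpha>) * s powr (- 2 - \<alpha>)) has_real_derivative
      (- 1 - \<alpha>) * ((- 2 - \<alpha>) * s powr (- 3 - \<alpha>))) (at s within {0..x})"
    using powr_has_derivative[OF s(2), of "- 2 - \<alpha>"] by (intro DERIV_cmult) simp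
  show "(\<phi> has_real_derivative \<phi>1 s) (at s within {0..x})"
    using DERIV_mult[OF q_deriv[OF s(1)] p] unfolding \<phi>_def \<phi>1_def by (simp add: mult_ac)
  show "(\<phi>1 has_real_derivative \<phi>2 s) (at s within {0..x})"
    using DERIV_add[OF DERIV_mult[OF q1_deriv[OF s(1)] p] DERIV_mult[OF q_deriv[OF s(1)] p1]]
    unfolding \<phi>1_def \<phi>2_def by (simp add: algebra_simps)
qed

text \<open>
  The double zero of \<open>q\<close> makes each of the three terms of \<open>\<phi>2\<close> comparable to \<open>s powr (- 1 - \<alpha>)\<close>; their
  coefficients are at most \<open>1\<close>, \<open>2 * 2\<close> and \<open>2 * 3\<close>, whence the constant.
\<close>

lemma \<phi>2_le:
  assumes "s \<in> {0<..x}"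
  shows "\<bar>\<phi>2 s\<bar> \<le> 11 * M * s powr (- 1 - \<alpha>)"
proof -
  let ?P = "s powr (- 1 - \<alpha>)"
  have s: "s \<in> {0..x}" "s > 0" using assms by auto
  have P: "s powr (- 2 - \<alpha>) = ?P / s" "s powr (- 3 - \<alpha>) = ?P / s\<^sup>2"
  proof -
    have e: "- 2 - \<alpha> = - 1 - \<alpha> - 1" "- 3 - \<alpha> = - 1 - \<alpha> - 2" by simp_all
    show "s powr (- 2 - \<alpha>) = ?P / s" "s powr (- 3 - \<alpha>) = ?P / s\<^sup>2"
      unfolding e powr_diff[of s "- 1 - \<alpha>"] using s by simp_all
  qed
  define A where "A = q1 s / s"
  define B where "B = q s / s\<^sup>2"
  have "\<bar>A\<bar> \<le> M" "\<bar>B\<bar> \<le> M"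
    using q1_le[OF s(1)] q_le[OF s(1)] s(2)
    by (simp_all add: A_def B_def abs_divide pos_divide_le_eq)
  moreover have "\<bar>2 * (1 + \<alpha>)\<bar> \<le> 4" using \<alpha> by simp
  moreover have "\<bar>(1 + \<alpha>) * (2 + \<alpha>)\<bar> \<le> 2 * 3" unfolding abs_mult using \<alpha> by (intro mult_mono) auto
  ultimately have "\<bar>2 * (1 + \<alpha>) * A\<bar> \<le> 4 * M" "\<bar>(1 + \<alpha>) * (2 + \<alpha>) * B\<bar> \<le> 2 * 3 * M"
    by (simp_all only: abs_mult[of _ A] abs_mult[of _ B] mult_mono abs_ge_zero mult_nonneg_nonneg
        zero_le_numeral)
  then have "\<bar>q2 s - 2 * (1 + \<alpha>) * A + (1 + \<alpha>) * (2 + \<alpha>) * B\<bar> \<le> M + 4 * M + 2 * 3 * M"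
    using q2_le[OF s(1)] by (smt (verit))
  moreover have "\<phi>2 s = q2 s * ?P + 2 * (A * ((- 1 - \<alpha>) * ?P)) + B * ((- 1 - \<alpha>) * ((- 2 - \<alpha>) * ?P))"
    unfolding \<phi>2_def P A_def B_def by simp
  then have "\<phi>2 s = ?P * (q2 s - 2 * (1 + \<alpha>) * A + (1 + \<alpha>) * (2 + \<alpha>) * B)"
    by (simp add: algebra_simps)
  ultimately have "\<bar>\<phi>2 s\<bar> \<le> ?P * (M + 4 * M + 2 * 3 * M)"
    by (simp only: abs_mult abs_of_nonneg[OF powr_ge_zero] mult_left_mono powr_ge_zero)
  then show ?thesis by (simp add: mult_ac)
qed

lemma panel_error:
  assumes "h > 0" "k \<ge> 1" "real (Suc k) * h \<le> x"
  shows "\<bar>h / 2 * (\<phi> (real k * h) + \<phi> (real (Suc k) * h)) - (\<Phi> (real (Suc k) * h) - \<Phi> (real k * h))\<bar>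
    \<le> 6 * M * h powr (2 - \<alpha>) * real k powr (- 1 - \<alpha>)"
proof -
  let ?a = "real k * h" and ?b = "real (Suc k) * h"
  have pos: "0 < ?a" "?a \<le> ?b" using assms by auto
  have sub: "s \<in> {0<..x}" "s \<in> {0..x}" if "s \<in> {?a..?b}" for s
    using that pos(1) assms(3) unfolding greaterThanAtMost_iff atLeastAtMost_iff by linarith+
  have subset: "{?a..?b} \<subseteq> {0..x}" using sub by blast
  have hk: "?b - ?a = h" by (simp add: algebra_simps)
  have "norm (((?b - ?a) / 2) *\<^sub>R (\<phi> ?a + \<phi> ?b) - (\<Phi> ?b - \<Phi> ?a))
    \<le> 11 * M * ?a powr (- 1 - \<alpha>) * (?b - ?a) ^ 3 / 2"
  proof (rule trapezoid_error[of _ _ _ _ \<phi>1 \<phi>2])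
    fix s assume s: "s \<in> {?a..?b}"
    show "(\<Phi> has_vector_derivative \<phi> s) (at s within {?a..?b})"
      using DERIV_subset[OF \<Phi>_deriv[OF sub(2)[OF s]] subset]
      by (simp add: has_real_derivative_iff_has_vector_derivative)
    show "(\<phi> has_vector_derivative \<phi>1 s) (at s within {?a..?b})"
      using DERIV_subset[OF \<phi>_derivs(1)[OF sub(1)[OF s]] subset]
      by (simp add: has_real_derivative_iff_has_vector_derivative)
    show "(\<phi>1 has_vector_derivative \<phi>2 s) (at s within {?a..?b})"
      using DERIV_subset[OF \<phi>_derivs(2)[OF sub(1)[OF s]] subset]
      by (simp add: has_real_derivative_iff_has_vector_derivative)
    have "\<bar>\<phi>2 s\<bar> \<le> 11 * M * s powr (- 1 - \<alpha>)"
      using sub(1)[OF s] by (rule \<phi>2_le)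
    also have "\<dots> \<le> 11 * M * ?a powr (- 1 - \<alpha>)"
      using s pos \<alpha> M_nonneg by (intro mult_left_mono powr_mono2') auto
    finally show "norm (\<phi>2 s) \<le> 11 * M * ?a powr (- 1 - \<alpha>)" by simp
  qed (use pos in auto)
  also have "11 * M * ?a powr (- 1 - \<alpha>) * (?b - ?a) ^ 3 / 2
      = 11 / 2 * (M * h powr (2 - \<alpha>) * real k powr (- 1 - \<alpha>))"
  proof -
    have "h powr (- 1 - \<alpha>) * h ^ 3 = h powr (2 - \<alpha>)"
      using powr_add[of h "- 1 - \<alpha>" 3] assms(1) by simp
    then show ?thesis
      unfolding hk using assms(1) by (simp add: powr_mult mult_ac)
  qed
  also have "\<dots> \<le> 6 * (M * h powr (2 - \<alpha>) * real k powr (- 1 - \<alpha>))"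
    using M_nonneg by (intro mult_right_mono) auto
  finally show ?thesis unfolding hk by (simp add: mult_ac)
qed

text \<open>
  On \<open>[0, h]\<close> the second derivative of \<open>\<phi>\<close> may be unbounded, so there the integral and its trapezoid
  approximation are estimated separately, both by the size of \<open>\<phi>\<close>. On the other panels \<open>panel_error\<close>
  applies, and the convergence of \<open>\<Sum>k powr (- 1 - \<alpha>)\<close> gives a bound independent of \<open>n\<close>.
\<close>

lemma trapezoid_sum_error:
  "\<exists>K. \<forall>n\<ge>1. let h = x / real n in
     \<bar>h * (\<Sum>k = 1..<n. \<phi> (real k * h)) + h / 2 * \<phi> x - \<Phi> x\<bar> \<le> K * h powr (2 - \<alpha>)"
proof -
  define Z where "Z = (\<Sum>i. real (Suc i) powr (- 1 - \<alpha>))"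
  show ?thesis
  proof (intro exI allI impI, unfold Let_def)
    fix n :: nat assume n: "n \<ge> 1"
    define h where "h = x / real n"
    have h: "h > 0" "real n * h = x" using x n by (auto simp: h_def)
    have kh: "real k * h \<le> x" if "k \<le> n" for k
      using that h mult_right_mono[of "real k" "real n" h] by simp
    let ?E = "\<lambda>k. h / 2 * (\<phi> (real k * h) + \<phi> (real (Suc k) * h)) - (\<Phi> (real (Suc k) * h) - \<Phi> (real k * h))"
    \<comment> \<open>Stated for all \<open>m\<close> with \<open>h\<close> fixed, so that it can be proved by induction.\<close>
    have split: "h * (\<Sum>k = 1..<m. \<phi> (real k * h)) + h / 2 * \<phi> (real m * h) - \<Phi> (real m * h)
        = h / 2 * \<phi> h - \<Phi> h + (\<Sum>k = 1..<m. ?E k)" if "m \<ge> 1" for m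
      using that by (induction m rule: dec_induct) (simp_all add: algebra_simps)
    have "h \<in> {0..x}" using h kh[of 1] n by auto
    then have phi_h: "\<bar>\<phi> h\<bar> \<le> M * h powr (1 - \<alpha>)"
      unfolding \<phi>_def using q_powr_le[of h "- 1 - \<alpha>"] by simp
    have e1: "\<bar>h / 2 * \<phi> h\<bar> \<le> M * h powr (2 - \<alpha>)"
    proof -
      have "\<bar>h / 2 * \<phi> h\<bar> \<le> h * (M * h powr (1 - \<alpha>))"
        using phi_h unfolding abs_mult using h by (intro mult_mono) auto
      then show ?thesis using h by (simp add: powr_mult_base mult.left_commute)
    qed
    have e2: "\<bar>\<Phi> h\<bar> \<le> M * h powr (2 - \<alpha>)"
    proof -
      have "norm (\<Phi> h - \<Phi> 0) \<le> M * h powr (1 - \<alpha>) * (h - 0)"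
      proof (rule norm_increment_le[of 0 h h \<Phi> \<phi>])
        fix s assume s: "s \<in> {0..h}"
        then have sx: "s \<in> {0..x}" using \<open>h \<in> {0..x}\<close> by auto
        have "(\<Phi> has_real_derivative \<phi> s) (at s within {0..h})"
          by (rule DERIV_subset[OF \<Phi>_deriv[OF sx]]) (use \<open>h \<in> {0..x}\<close> in auto)
        then show "(\<Phi> has_vector_derivative \<phi> s) (at s within {0..h})"
          by (simp add: has_real_derivative_iff_has_vector_derivative)
        have "\<bar>\<phi> s\<bar> \<le> M * s powr (1 - \<alpha>)"
          unfolding \<phi>_def using q_powr_le[OF sx, of "- 1 - \<alpha>"] by simp
        also have "\<dots> \<le> M * h powr (1 - \<alpha>)"
          using s M_nonneg \<alpha> by (intro mult_left_mono powr_mono2) auto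
        finally show "norm (\<phi> s) \<le> M * h powr (1 - \<alpha>)" by simp
      qed (use h in auto)
      then show ?thesis using h by (simp add: \<Phi>_0 powr_mult_base mult.commute mult.left_commute)
    qed
    have "\<bar>\<Sum>k = 1..<n. ?E k\<bar> \<le> (\<Sum>k = 1..<n. 6 * M * h powr (2 - \<alpha>) * real k powr (- 1 - \<alpha>))"
      by (intro order_trans[OF sum_abs] sum_mono panel_error h(1) kh) auto
    also have "\<dots> = 6 * M * h powr (2 - \<alpha>) * (\<Sum>i<n - 1. real (Suc i) powr (- 1 - \<alpha>))"
    proof -
      have "(\<Sum>k = 1..<n. real k powr (- 1 - \<alpha>)) = (\<Sum>i<n - 1. real (Suc i) powr (- 1 - \<alpha>))"
        by (rule sum.reindex_bij_witness[of _ Suc "\<lambda>k. k - 1"]) auto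
      then show ?thesis by (simp add: sum_distrib_left[symmetric])
    qed
    also have "\<dots> \<le> 6 * M * h powr (2 - \<alpha>) * Z"
      unfolding Z_def using M_nonneg \<alpha> by (intro mult_left_mono sum_le_suminf summable_Suc_powr) auto
    finally have "\<bar>\<Sum>k = 1..<n. ?E k\<bar> \<le> 6 * M * Z * h powr (2 - \<alpha>)" by (simp add: mult_ac)
    then show "\<bar>x / real n * (\<Sum>k = 1..<n. \<phi> (real k * (x / real n))) + x / real n / 2 * \<phi> x - \<Phi> x\<bar>
        \<le> (2 * M + 6 * M * Z) * (x / real n) powr (2 - \<alpha>)"
      using split[OF n] e1 e2 unfolding h(2) h_def[symmetric] by (simp add: algebra_simps)
  qed
qed

section \<open>The error of the quadrature rule\<close>

text \<open>
  Write \<open>e0\<close>, \<open>e1\<close> for the errors of \<open>S_zeta_expansion\<close> at \<open>\<alpha>\<close> and \<open>\<alpha> + 1\<close>. The leading terms cancel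
  in the factor \<open>A\<close> of the backward difference, which leaves \<open>A = e0 - n * e1\<close>, while those
  of \<open>- S_zeta n (\<alpha> + 1) * q x\<close> are the boundary term and the missing half weight at \<open>x\<close>. Every other
  contribution is \<open>O(h\<^sup>2)\<close>; in particular so is \<open>zeta_real \<alpha> * q h\<close>, the deviation of the
  weight at \<open>h\<close> from the power \<open>1\<close>.
\<close>

lemma quadrature_remainder:
  "\<exists>K. \<forall>n\<ge>4. let h = x / real n in
     \<bar>(\<Sum>k = 0..n. \<sigma> \<alpha> n k * q (real k * h)) - h powr \<alpha> / \<alpha> * (q x * x powr (- \<alpha>) + \<alpha> * \<Phi> x)\<bar>
       \<le> K * h\<^sup>2"
proof -
  obtain K where K: "\<And>n. n \<ge> 1 \<Longrightarrow>
     \<bar>x / real n * (\<Sum>k = 1..<n. \<phi> (real k * (x / real n))) + x / real n / 2 * \<phi> x - \<Phi> x\<bar>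
       \<le> K * (x / real n) powr (2 - \<alpha>)"
    using trapezoid_sum_error unfolding Let_def by blast
  show ?thesis
  proof (intro exI allI impI, unfold Let_def)
    fix n :: nat assume n: "n \<ge> 4"
    define h where "h = x / real n"
    have n0: "real n > 0" "real n \<ge> 1" using n by auto
    have h: "h > 0" "real n * h = x" using x n0 by (auto simp: h_def)
    have hx: "h = x * (1 / real n)" by (simp add: h_def)
    have "h \<le> x" unfolding h_def using x n0 by (simp add: pos_divide_le_eq)
    define S0 where "S0 = S_zeta n \<alpha>"
    define S1 where "S1 = S_zeta n (\<alpha> + 1)"
    define c where "c = real n powr (1 - \<alpha>) / (\<alpha> * (1 - \<alpha>))"
    define e0 where "e0 = S0 - (real n powr (1 - \<alpha>) / (1 - \<alpha>) - real n powr (- \<alpha>) / 2)"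
    define e1 where "e1 = S1 + (real n powr (- \<alpha>) / \<alpha> + real n powr (- 1 - \<alpha>) / 2)"
    define A where "A = S0 - real n * S1 - c"
    define T where "T = h * (\<Sum>k = 1..<n. \<phi> (real k * h)) + h / 2 * \<phi> x - \<Phi> x"
    have e0: "\<bar>e0\<bar> \<le> 2 / real n"
    proof -
      have "\<bar>e0\<bar> \<le> \<alpha> * (\<alpha> + 1) * real n powr (- \<alpha> - 1)"
        unfolding e0_def S0_def using S_zeta_expansion[of \<alpha> n] \<alpha> n by simp
      also have "\<dots> \<le> (1 * 2) * real n powr (- 1)"
        using \<alpha> n0 by (intro mult_mono powr_mono) auto
      finally show ?thesis using n0 by (simp add: powr_minus divide_inverse)
    qed
    have e1: "\<bar>e1\<bar> \<le> 6 / (real n)\<^sup>2"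
    proof -
      have "\<bar>e1\<bar> \<le> (\<alpha> + 1) * (\<alpha> + 1 + 1) * real n powr (- (\<alpha> + 1) - 1)"
        using S_zeta_expansion[of "\<alpha> + 1" n] \<alpha> n unfolding e1_def S1_def
        by (simp add: algebra_simps)
      also have "\<dots> \<le> (2 * 3) * real n powr (- 2)"
        using \<alpha> n0 by (intro mult_mono powr_mono) auto
      finally show ?thesis using n0 by (simp add: powr_minus divide_inverse)
    qed
    have A: "\<bar>A\<bar> \<le> 8 / real n"
    proof -
      have p: "real n powr (1 - \<alpha>) = real n * real n powr (- \<alpha>)"
        "real n * real n powr (- 1 - \<alpha>) = real n powr (- \<alpha>)"
        using n0 by (simp_all add: powr_mult_base)
      have "A = e0 - real n * e1 + (real n * real n powr (- 1 - \<alpha>)) / 2 - real n powr (- \<alpha>) / 2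
          + real n * real n powr (- \<alpha>) / \<alpha> + real n powr (1 - \<alpha>) / (1 - \<alpha>) - c"
        by (simp add: A_def e0_def e1_def algebra_simps)
      also have "\<dots> = e0 - real n * e1
          + real n powr (1 - \<alpha>) * (1 / \<alpha> + 1 / (1 - \<alpha>) - 1 / (\<alpha> * (1 - \<alpha>)))"
        unfolding p(2) c_def p(1)[symmetric] by (simp add: algebra_simps)
      also have "1 / \<alpha> + 1 / (1 - \<alpha>) - 1 / (\<alpha> * (1 - \<alpha>)) = 0"
        using \<alpha> by (simp add: divide_simps)
      finally have "\<bar>A\<bar> \<le> \<bar>e0\<bar> + \<bar>real n * e1\<bar>" by simp
      also have "\<bar>real n * e1\<bar> \<le> real n * (6 / (real n)\<^sup>2)"
        unfolding abs_mult using e1 n0 by (intro mult_mono) auto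
      also have "real n * (6 / (real n)\<^sup>2) = 6 / real n" using n0 by (simp add: power2_eq_square)
      finally show ?thesis using e0 by simp
    qed
    have b1: "\<bar>zeta_real \<alpha> * q h\<bar> \<le> \<bar>zeta_real \<alpha>\<bar> * M * h\<^sup>2"
      using q_le[of h] h \<open>h \<le> x\<close> by (simp add: abs_mult mult.assoc mult_left_mono)
    have b2: "\<bar>A * (q (real (n - 1) * h) - q x)\<bar> \<le> 8 * M * h\<^sup>2"
    proof -
      have nh: "real (n - 1) * h = x - h" using n h by (simp add: of_nat_diff algebra_simps)
      have "\<bar>q (real (n - 1) * h) - q x\<bar> \<le> M * x * h"
        using q_diff_le[of "x - h" x] h \<open>h \<le> x\<close> unfolding nh by (simp add: abs_minus_commute)
      then have "\<bar>A * (q (real (n - 1) * h) - q x)\<bar> \<le> 8 / real n * (M * x * h)"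
        unfolding abs_mult using A n0 by (intro mult_mono) auto
      also have "\<dots> = 8 * M * h\<^sup>2" by (simp add: hx power2_eq_square)
      finally show ?thesis .
    qed
    have b3: "\<bar>e1 * q x\<bar> \<le> 6 * M * h\<^sup>2"
    proof -
      have "\<bar>e1 * q x\<bar> \<le> 6 / (real n)\<^sup>2 * (M * x\<^sup>2)"
        unfolding abs_mult using e1 q_le[of x] x by (intro mult_mono) auto
      then show ?thesis by (simp add: hx power_divide mult_ac)
    qed
    have b4: "\<bar>h powr \<alpha> * T\<bar> \<le> K * h\<^sup>2"
    proof -
      have "\<bar>h powr \<alpha> * T\<bar> \<le> h powr \<alpha> * (K * h powr (2 - \<alpha>))"
        using K[of n] n unfolding T_def h_def[symmetric] by (simp add: abs_mult mult_left_mono)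
      also have "\<dots> = K * (h powr \<alpha> * h powr (2 - \<alpha>))" by simp
      also have "h powr \<alpha> * h powr (2 - \<alpha>) = h\<^sup>2"
        using h by (simp add: powr_add[symmetric])
      finally show ?thesis .
    qed
    have scale: "real k powr p = h powr (- p) * (real k * h) powr p" for k p
      using h by (simp add: powr_mult powr_minus)
    have ha: "h powr (\<alpha> + 1) = h powr \<alpha> * h" using h by (simp add: powr_add)
    have \<phi>_eq: "real k powr (- 1 - \<alpha>) * q (real k * h) = h powr \<alpha> * (h * \<phi> (real k * h))" for k
      using scale[of k "- 1 - \<alpha>"] by (simp add: \<phi>_def ha)
    have sum_eq: "(\<Sum>k = 1..<n. real k powr (- 1 - \<alpha>) * q (real k * h))
        = h powr \<alpha> * (h * (\<Sum>k = 1..<n. \<phi> (real k * h)))"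
      unfolding \<phi>_eq by (simp add: sum_distrib_left)
    have end_eq: "real n powr (- 1 - \<alpha>) / 2 * q x = h powr \<alpha> * (h / 2 * \<phi> x)"
      using \<phi>_eq[of n] unfolding h(2) by simp
    have bdry_eq: "real n powr (- \<alpha>) / \<alpha> * q x = h powr \<alpha> / \<alpha> * (q x * x powr (- \<alpha>))"
      using scale[of n "- \<alpha>"] unfolding h(2) by simp
    have "(\<Sum>k = 0..n. \<sigma> \<alpha> n k * q (real k * h))
        = - zeta_real \<alpha> * q h + h powr \<alpha> * (h * (\<Sum>k = 1..<n. \<phi> (real k * h)))
          + A * (q (real (n - 1) * h) - q x) - S1 * q x"
      using sigma_sum_eq[OF n, of \<alpha> "\<lambda>k. q (real k * h)"] unfolding sum_eq
      by (simp add: q_0 h(2) A_def S0_def S1_def c_def)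
    also have "S1 * q x = e1 * q x - real n powr (- \<alpha>) / \<alpha> * q x - real n powr (- 1 - \<alpha>) / 2 * q x"
      by (simp add: e1_def algebra_simps)
    also have "\<dots> = e1 * q x - h powr \<alpha> / \<alpha> * (q x * x powr (- \<alpha>)) - h powr \<alpha> * (h / 2 * \<phi> x)"
      by (simp only: end_eq bdry_eq)
    finally have "(\<Sum>k = 0..n. \<sigma> \<alpha> n k * q (real k * h))
          - h powr \<alpha> / \<alpha> * (q x * x powr (- \<alpha>) + \<alpha> * \<Phi> x)
        = - (zeta_real \<alpha> * q h) + h powr \<alpha> * T + A * (q (real (n - 1) * h) - q x) - e1 * q x"
      using \<alpha> by (simp add: T_def ring_distribs)
    also have "\<bar>\<dots>\<bar> \<le> \<bar>zeta_real \<alpha>\<bar> * M * h\<^sup>2 + K * h\<^sup>2 + 8 * M * h\<^sup>2 + 6 * M * h\<^sup>2"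
      using b1 b2 b3 b4 by linarith
    finally show "\<bar>(\<Sum>k = 0..n. \<sigma> \<alpha> n k * q (real k * (x / real n)))
          - (x / real n) powr \<alpha> / \<alpha> * (q x * x powr (- \<alpha>) + \<alpha> * \<Phi> x)\<bar>
        \<le> (\<bar>zeta_real \<alpha>\<bar> * M + K + 8 * M + 6 * M) * (x / real n)\<^sup>2"
      unfolding h_def[symmetric] by (simp only: ring_distribs)
  qed
qed

text \<open>
  Integration by parts in the form of an explicit antiderivative \<open>H\<close>, written in the reflected variable.
  It extends continuously to the singular point because \<open>q s * s powr - \<alpha> = O(s powr (2 - \<alpha>))\<close>.
\<close>

lemma has_integral_against_kernel:
  "((\<lambda>t. (d - q1 (x - t)) / (x - t) powr \<alpha>) has_integral
     d * x powr (1 - \<alpha>) / (1 - \<alpha>) - (q x * x powr (- \<alpha>) + \<alpha> * \<Phi> x)) {0..x}"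
proof -
  define H where "H = (\<lambda>s. d / (1 - \<alpha>) * s powr (1 - \<alpha>) - q s * s powr (- \<alpha>) - \<alpha> * \<Phi> s)"
  have H_deriv: "(H has_real_derivative (d - q1 s) * s powr (- \<alpha>)) (at s within {0..x})"
    if s: "s \<in> {0<..x}" for s
  proof -
    have s': "s > 0" "s \<in> {0..x}" using s by auto
    have "(H has_real_derivative
        d / (1 - \<alpha>) * ((1 - \<alpha>) * s powr (1 - \<alpha> - 1))
        - (q1 s * s powr (- \<alpha>) + (- \<alpha> * s powr (- \<alpha> - 1)) * q s) - \<alpha> * \<phi> s) (at s within {0..x})"
      unfolding H_def
      by (intro DERIV_diff DERIV_cmult DERIV_mult powr_has_derivative q_deriv \<Phi>_deriv s')
    moreover have "d / (1 - \<alpha>) * ((1 - \<alpha>) * z) = d * z" for z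
      using \<alpha> by simp
    moreover have "- \<alpha> - 1 = - 1 - \<alpha>" "1 - \<alpha> - 1 = - \<alpha>" by simp_all
    ultimately have "(H has_real_derivative d * s powr (- \<alpha>)
        - (q1 s * s powr (- \<alpha>) + (- \<alpha> * s powr (- 1 - \<alpha>)) * q s) - \<alpha> * \<phi> s) (at s within {0..x})"
      by (simp only:)
    then show ?thesis
      by (simp add: \<phi>_def algebra_simps)
  qed
  have cont: "continuous_on {0..x} H"
  proof -
    have "continuous_on {0..x} \<Phi>"
      using DERIV_continuous_on[OF \<Phi>_deriv] by blast
    then show ?thesis
      unfolding H_def using \<alpha>
      by (intro continuous_intros continuous_on_q_powr continuous_on_powr') auto
  qed
  have "((\<lambda>t. (d - q1 (x - t)) * (x - t) powr (- \<alpha>)) has_integral - H (x - x) - - H (x - 0)) {0..x}"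
  proof (rule fundamental_theorem_of_calculus_interior)
    show "continuous_on {0..x} (\<lambda>t. - H (x - t))"
      by (intro continuous_on_minus continuous_on_compose2[OF cont] continuous_intros) auto
    fix t assume t: "t \<in> {0<..<x}"
    then have "(H has_real_derivative (d - q1 (x - t)) * (x - t) powr (- \<alpha>)) (at (x - t))"
      using H_deriv[of "x - t"] at_within_Icc_at[of 0 "x - t" x] by auto
    then have "((\<lambda>t. H (x - t)) has_real_derivative (d - q1 (x - t)) * (x - t) powr (- \<alpha>) * (0 - 1)) (at t)"
      by (rule DERIV_chain2) (intro DERIV_diff DERIV_const DERIV_ident)
    from DERIV_minus[OF this]
    show "((\<lambda>t. - H (x - t)) has_vector_derivative (d - q1 (x - t)) * (x - t) powr (- \<alpha>)) (at t)"
      by (simp add: has_real_derivative_iff_has_vector_derivative)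
  qed (use x in auto)
  then show ?thesis
    by (simp add: H_def \<Phi>_0 powr_minus divide_inverse algebra_simps)
qed

end

lemma C_infinity_on_reflected_remainder:
  assumes "0 < \<alpha>" "\<alpha> < 1" "x > 0" and "C_infinity_on {0..x} y"
  obtains d q q1 q2 M where "double_zero \<alpha> x M q q1 q2"
    and "\<And>s. s \<in> {0..x} \<Longrightarrow> y (x - s) = y x - d * s + q s"
    and "\<And>t. t \<in> {0..x} \<Longrightarrow> vector_derivative y (at t within {0..x}) = d - q1 (x - t)"
proof -
  obtain D where D: "\<And>t. t \<in> {0..x} \<Longrightarrow> D 0 t = y t"
    and D': "\<And>k t. t \<in> {0..x} \<Longrightarrow> (D k has_real_derivative D (Suc k) t) (at t within {0..x})"
    using assms(4) unfolding C_infinity_on_def by blast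
  have refl: "((\<lambda>s. D k (x - s)) has_real_derivative - D (Suc k) (x - s)) (at s within {0..x})"
    if "s \<in> {0..x}" for k s
  proof -
    have outer: "(D k has_real_derivative D (Suc k) (x - s)) (at (x - s) within (\<lambda>s. x - s) ` {0..x})"
      using D'[of "x - s" k] that by simp
    have inner: "((\<lambda>s. x - s) has_real_derivative 0 - 1) (at s within {0..x})"
      by (intro DERIV_diff DERIV_const DERIV_ident)
    show ?thesis
      using DERIV_image_chain[OF outer inner] by (simp add: o_def)
  qed
  \<comment> \<open>Boundedness of the second derivative is where compactness of \<open>[0, x]\<close> enters.\<close>
  have "continuous_on {0..x} (D 2)"
    using DERIV_continuous_on[OF D'[of _ 2]] by blast
  then have "bounded (D 2 ` {0..x})"
    by (intro compact_imp_bounded compact_continuous_image) auto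
  then obtain M where "\<forall>z\<in>D 2 ` {0..x}. norm z \<le> M"
    unfolding bounded_iff by blast
  then have M: "\<bar>D 2 t\<bar> \<le> M" if "t \<in> {0..x}" for t
    using that by auto
  define q where "q = (\<lambda>s. D 0 (x - s) - D 0 x + D 1 x * s)"
  define q1 where "q1 = (\<lambda>s. - D 1 (x - s) + D 1 x)"
  define q2 where "q2 = (\<lambda>s. D 2 (x - s))"
  show thesis
  proof (rule that[of M q q1 q2 "D 1 x"])
    show "double_zero \<alpha> x M q q1 q2"
    proof
      fix s assume s: "s \<in> {0..x}"
      show "(q has_real_derivative q1 s) (at s within {0..x})"
        unfolding q_def q1_def
        using DERIV_add[OF DERIV_diff[OF refl[OF s, of 0] DERIV_const] DERIV_cmult[OF DERIV_ident]]
        by simp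
      show "(q1 has_real_derivative q2 s) (at s within {0..x})"
        unfolding q1_def q2_def
        using DERIV_add[OF DERIV_minus[OF refl[OF s, of 1]] DERIV_const]
        by (simp add: numeral_2_eq_2)
      show "\<bar>q2 s\<bar> \<le> M" using M[of "x - s"] s by (simp add: q2_def)
    qed (use assms in \<open>simp_all add: q_def q1_def\<close>)
    show "y (x - s) = y x - D 1 x * s + q s" if "s \<in> {0..x}" for s
      using that assms(3) by (simp add: q_def D)
    fix t assume t: "t \<in> {0..x}"
    have "(D 0 has_vector_derivative D 1 t) (at t within {0..x})"
      using D'[OF t, of 0] by (simp add: has_real_derivative_iff_has_vector_derivative)
    then have "(y has_vector_derivative D 1 t) (at t within {0..x})"
      by (rule has_vector_derivative_transform[OF t, rotated]) (simp add: D)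
    then show "vector_derivative y (at t within {0..x}) = D 1 x - q1 (x - t)"
      using assms(3) t by (simp add: q1_def vector_derivative_within_closed_interval)
  qed
qed

theorem mainTheorem3:
  fixes \<alpha> x :: real and y :: "real \<Rightarrow> real"
  assumes "0 < \<alpha>" and "\<alpha> < 1" and "x > 0" and "C_infinity_on {0..x} y"
  shows "(\<lambda>n::nat. let h = x / real n in
      1 / (Gamma (- \<alpha>) * h powr \<alpha>) * (\<Sum>k = 0..n. \<sigma> \<alpha> n k * y (real (n - k) * h))
        - caputo_derivative \<alpha> y x)
    \<in> O[sequentially](\<lambda>n. (x / real n) powr (2 - \<alpha>))"
proof -
  obtain d q q1 q2 M where dz: "double_zero \<alpha> x M q q1 q2"
    and y_eq: "\<And>s. s \<in> {0..x} \<Longrightarrow> y (x - s) = y x - d * s + q s"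
    and y': "\<And>t. t \<in> {0..x} \<Longrightarrow> vector_derivative y (at t within {0..x}) = d - q1 (x - t)"
    using C_infinity_on_reflected_remainder[OF assms] by metis
  interpret double_zero \<alpha> x M q q1 q2 by (rule dz)
  define W where "W = q x * x powr (- \<alpha>) + \<alpha> * \<Phi> x"
  define G where "G = Gamma (- \<alpha>)"
  have "- \<alpha> \<notin> \<int>\<^sub>\<le>\<^sub>0"
  proof
    assume "- \<alpha> \<in> \<int>\<^sub>\<le>\<^sub>0"
    then obtain m where "- \<alpha> = - real m" by (elim nonpos_Ints_cases') auto
    then show False using \<alpha> by (cases m) auto
  qed
  then have G: "G \<noteq> 0" "Gamma (1 - \<alpha>) = - \<alpha> * G"
    unfolding G_def using Gamma_plus1[of "- \<alpha>"] by (simp_all add: Gamma_eq_zero_iff)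
  have "integral {0..x} (\<lambda>t. vector_derivative y (at t within {0..x}) / (x - t) powr \<alpha>)
      = integral {0..x} (\<lambda>t. (d - q1 (x - t)) / (x - t) powr \<alpha>)"
    by (intro integral_cong) (simp add: y')
  also have "\<dots> = d * x powr (1 - \<alpha>) / (1 - \<alpha>) - W"
    unfolding W_def by (rule integral_unique[OF has_integral_against_kernel])
  finally have integral_eq: "integral {0..x} (\<lambda>t. vector_derivative y (at t within {0..x}) / (x - t) powr \<alpha>)
      = d * x powr (1 - \<alpha>) / (1 - \<alpha>) - W" .
  have "1 / (- \<alpha> * G) * (z - W) = (W - z) / (\<alpha> * G)" for z
    using \<alpha> G(1) by (simp add: divide_simps)
  then have caputo: "caputo_derivative \<alpha> y x = (W - d * x powr (1 - \<alpha>) / (1 - \<alpha>)) / (\<alpha> * G)"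
    unfolding caputo_derivative_def G(2) integral_eq .
  obtain K where K: "\<And>n. n \<ge> 4 \<Longrightarrow>
      \<bar>(\<Sum>k = 0..n. \<sigma> \<alpha> n k * q (real k * (x / real n))) - (x / real n) powr \<alpha> / \<alpha> * W\<bar>
        \<le> K * (x / real n)\<^sup>2"
    using quadrature_remainder unfolding Let_def W_def by blast
  show ?thesis
  proof (rule bigoI[of _ "K / \<bar>G\<bar>"], rule eventually_mono[OF eventually_ge_at_top[of 4]])
    fix n :: nat assume n: "n \<ge> 4"
    define h where "h = x / real n"
    have h: "h > 0" "real n * h = x" using x n by (auto simp: h_def)
    define Q where "Q = (\<Sum>k = 0..n. \<sigma> \<alpha> n k * q (real k * h))"
    have "(\<Sum>k = 0..n. \<sigma> \<alpha> n k * y (real (n - k) * h))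
        = (\<Sum>k = 0..n. y x * \<sigma> \<alpha> n k - d * h * (\<sigma> \<alpha> n k * real k) + \<sigma> \<alpha> n k * q (real k * h))"
    proof (rule sum.cong)
      fix k assume k: "k \<in> {0..n}"
      then have node: "real (n - k) * h = x - real k * h"
        using h(2) by (simp add: of_nat_diff left_diff_distrib)
      have mem: "real k * h \<in> {0..x}"
        using k h mult_right_mono[of "real k" "real n" h] by simp
      show "\<sigma> \<alpha> n k * y (real (n - k) * h)
          = y x * \<sigma> \<alpha> n k - d * h * (\<sigma> \<alpha> n k * real k) + \<sigma> \<alpha> n k * q (real k * h)"
        unfolding node y_eq[OF mem] by (simp add: algebra_simps)
    qed simp
    also have "\<dots> = y x * (\<Sum>k = 0..n. \<sigma> \<alpha> n k) - d * h * (\<Sum>k = 0..n. \<sigma> \<alpha> n k * real k) + Q"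
      by (simp add: Q_def sum.distrib sum_subtractf sum_distrib_left)
    also have "\<dots> = Q - d * (h * (real n powr (1 - \<alpha>) / (\<alpha> * (1 - \<alpha>))))"
      unfolding sigma_sum_const[OF n] sigma_sum_linear[OF n] by simp
    also have "h * (real n powr (1 - \<alpha>) / (\<alpha> * (1 - \<alpha>))) = h powr \<alpha> * (x powr (1 - \<alpha>) / (\<alpha> * (1 - \<alpha>)))"
    proof -
      have "x powr (1 - \<alpha>) = real n powr (1 - \<alpha>) * h powr (1 - \<alpha>)"
        unfolding h(2)[symmetric] using h(1) by (simp add: powr_mult)
      moreover have "h powr \<alpha> * h powr (1 - \<alpha>) = h"
        using h(1) by (simp add: powr_add[symmetric])
      ultimately show ?thesis by (simp add: mult_ac)
    qed
    finally have "1 / (G * h powr \<alpha>) * (\<Sum>k = 0..n. \<sigma> \<alpha> n k * y (real (n - k) * h)) - caputo_derivative \<alpha> y x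
        = 1 / (G * h powr \<alpha>) * (Q - h powr \<alpha> / \<alpha> * W)"
      unfolding caputo using \<alpha> G(1) h(1) by (simp add: divide_simps) (simp add: algebra_simps)
    also have "\<bar>\<dots>\<bar> \<le> 1 / (\<bar>G\<bar> * h powr \<alpha>) * (K * h\<^sup>2)"
      unfolding abs_mult using K[OF n] unfolding h_def[symmetric] Q_def[symmetric]
      by (intro mult_mono) (auto simp: abs_mult)
    also have "\<dots> = K / \<bar>G\<bar> * (h\<^sup>2 / h powr \<alpha>)" by simp
    also have "h\<^sup>2 / h powr \<alpha> = h powr (2 - \<alpha>)" using h(1) by (simp add: powr_diff)
    finally show "norm (let h = x / real n in
        1 / (Gamma (- \<alpha>) * h powr \<alpha>) * (\<Sum>k = 0..n. \<sigma> \<alpha> n k * y (real (n - k) * h))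
          - caputo_derivative \<alpha> y x) \<le> K / \<bar>G\<bar> * norm ((x / real n) powr (2 - \<alpha>))"
      unfolding Let_def h_def[symmetric] G_def[symmetric] by simp
  qed
qed

end
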